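(* Let $k,n\ge 1$ be integers and $0\le r\le (k-1)n$. Let $\alpha_r$ be the number of distinct permutations of the multiset consisting of $k$ copies of each integer $1,\dots,n$ that have exactly $r$ matches. Then $$\alpha_r=\sum_{m=r}^{(k-1)n}(-1)^{m-r}\binom{m}{r}\beta_m,$$ where for $0\le m\le (k-1)n$ $$\beta_m=\sum_{\substack{\sum_\pi s_\pi=n\\ \sum_\pi s_\pi\mu(\pi)=m}}\binom{n}{(s_\pi)}\frac{(kn-m)!}{\prod_{\pi\in\mathcal{P}(k)}\prod_{i=1}^k(\pi_i!)^{s_\pi}},$$ the sum being over all families $(s_\pi)_{\pi\in\mathcal{P}(k)}$ of nonnegative integers satisfying the two indicated conditions (sums over $\pi\in\mathcal{P}(k)$).
   Context: A permutation of the multiset is a sequence $(a_1,\dots,a_{kn})$ in which each of $1,\dots,n$ appears exactly $k$ times; its number of matches is the number of indices $i$ with $1\le i\le kn-1$ and $a_i=a_{i+1}$. $\mathcal{P}(k)$ is the set of partitions of $k$, a partition being represented by the vector $\pi=(\pi_1,\dots,\pi_k)$ of nonnegative integers with $\sum_{i=1}^k i\,\pi_i=k$, where $\pi_i$ is the number of parts equal to $i$. Put $\mu(\pi)=\sum_{i=1}^k\pi_i(i-1)$. $\binom{n}{(s_\pi)}=\frac{n!}{\prod_{\pi\in\mathcal{P}(k)}s_\pi!}$ is the multinomial coefficient. *)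

theory Defs
  imports Complex_Main "HOL-Library.FuncSet" "HOL-Combinatorics.Multiset_Permutations"
begin

definition copies_mset :: "nat \<Rightarrow> nat \<Rightarrow> nat multiset" where
  "copies_mset k n = repeat_mset k (mset_set {1..n})"

lemma count_copies_mset:
  "count (copies_mset k n) j = (if j \<in> {1..n} then k else 0)"
  by (simp add: copies_mset_def)

text \<open>Lists are indexed from 0, so the index \<open>i\<close> below corresponds to the match
  \<open>a\<^sub>i\<^sub>+\<^sub>1 = a\<^sub>i\<^sub>+\<^sub>2\<close> in 1-based notation.\<close>

definition matches :: "'a list \<Rightarrow> nat" where
  "matches a = card {i. Suc i < length a \<and> a ! i = a ! Suc i}"

definition alpha :: "nat \<Rightarrow> nat \<Rightarrow> nat \<Rightarrow> nat" where
  "alpha k n r = card {a \<in> permutations_of_multiset (copies_mset k n). matches a = r}"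

text \<open>A vector \<open>(\<pi>\<^sub>1, \<dots>, \<pi>\<^sub>k)\<close> is represented by a function that vanishes
  outside \<open>{1..k}\<close>, so that each partition has exactly one representative.\<close>

definition partitions :: "nat \<Rightarrow> (nat \<Rightarrow> nat) set" where
  "partitions k = {p. (\<forall>i. i \<notin> {1..k} \<longrightarrow> p i = 0) \<and> (\<Sum>i=1..k. i * p i) = k}"

definition mu :: "nat \<Rightarrow> (nat \<Rightarrow> nat) \<Rightarrow> nat" where
  "mu k p = (\<Sum>i=1..k. p i * (i - 1))"

text \<open>Families indexed by \<open>partitions k\<close>; extensionality (\<open>\<rightarrow>\<^sub>E\<close>) gives each family
  exactly one representative.\<close>

definition families :: "nat \<Rightarrow> nat \<Rightarrow> nat \<Rightarrow> ((nat \<Rightarrow> nat) \<Rightarrow> nat) set" where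
  "families k n m = {s \<in> partitions k \<rightarrow>\<^sub>E UNIV.
     (\<Sum>p\<in>partitions k. s p) = n \<and> (\<Sum>p\<in>partitions k. s p * mu k p) = m}"

definition multinomial :: "nat \<Rightarrow> nat \<Rightarrow> ((nat \<Rightarrow> nat) \<Rightarrow> nat) \<Rightarrow> real" where
  "multinomial k n s = fact n / (\<Prod>p\<in>partitions k. fact (s p))"

definition beta :: "nat \<Rightarrow> nat \<Rightarrow> nat \<Rightarrow> real" where
  "beta k n m = (\<Sum>s\<in>families k n m. multinomial k n s *
     (fact (k * n - m) / (\<Prod>p\<in>partitions k. \<Prod>i=1..k. fact (p i) ^ s p)))"

text \<open>The sums and products above range over finite sets, so none of them
  degenerates to its default value.\<close>

lemma finite_partitions: "finite (partitions k)"
proof (rule finite_subset)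
  let ?B = "{f. \<forall>i. (i \<in> {1..k} \<longrightarrow> f i \<in> {..k}) \<and> (i \<notin> {1..k} \<longrightarrow> f i = (0::nat))}"
  show "finite ?B"
    by (rule finite_set_of_finite_funs) auto
  show "partitions k \<subseteq> ?B"
  proof
    fix p assume p: "p \<in> partitions k"
    have "p i \<le> k" if i: "i \<in> {1..k}" for i
    proof -
      have "p i \<le> i * p i" using i by simp
      also have "\<dots> \<le> (\<Sum>i=1..k. i * p i)"
        using i by (intro member_le_sum) auto
      also have "\<dots> = k" using p by (simp add: partitions_def)
      finally show ?thesis .
    qed
    with p show "p \<in> ?B" by (auto simp: partitions_def)
  qed
qed

lemma finite_families: "finite (families k n m)"
proof (rule finite_subset)
  show "finite (partitions k \<rightarrow>\<^sub>E {..n})"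
    by (intro finite_PiE finite_partitions) auto
  show "families k n m \<subseteq> partitions k \<rightarrow>\<^sub>E {..n}"
  proof
    fix s assume s: "s \<in> families k n m"
    have "s p \<le> n" if "p \<in> partitions k" for p
      using member_le_sum[of p "partitions k" s] that s finite_partitions
      by (auto simp: families_def)
    with s show "s \<in> partitions k \<rightarrow>\<^sub>E {..n}"
      by (auto simp: families_def PiE_iff)
  qed
qed

end

theory Submission
  imports Defs
begin

text \<open>
  The number \<open>\<beta>\<^sub>m\<close> counts pairs of a word \<open>a\<close> and a set of \<open>m\<close> of its matches, so that
  \<open>\<beta>\<^sub>m = (\<Sum>a. matches a choose m)\<close> (lemma \<open>sum_choose_matches_eq_beta\<close>). The theorem follows by
  binomial inversion, because \<open>(\<Sum>m. (-1) ^ (m - r) * (m choose r) * (M choose m))\<close> is \<open>1\<close>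
  for \<open>M = r\<close> and \<open>0\<close> otherwise (\<open>binomial_inversion_kernel\<close>).

  To evaluate \<open>\<beta>\<^sub>m\<close>, glue the two letters of every selected match together. The word turns into
  a list of \<open>kn - m\<close> blocks \<open>(x, l)\<close>, a block being a run of \<open>l\<close> letters \<open>x\<close> (not necessarily a
  maximal one), and the selection can be read off from this list; \<open>card_blocks\<close> is the resulting
  count for one word. The lengths of the blocks of a fixed letter form a partition of \<open>k\<close>.
  If \<open>p\<^sub>j\<close> is the partition that belongs to the letter \<open>j\<close>, the blocks can be arranged in
  \<open>(kn - m)! / (\<Prod>j. \<Prod>i. (p\<^sub>j i)!)\<close> ways. A partition \<open>p\<close> of \<open>k\<close> has \<open>k - \<mu>(p)\<close> parts, so the
  number of blocks is \<open>kn - m\<close> exactly when the \<open>\<mu>(p\<^sub>j)\<close> add up to \<open>m\<close>. The number of arrangements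
  depends only on how often each partition \<open>p\<close> occurs among \<open>p\<^sub>1, \<dots>, p\<^sub>n\<close>; calling this
  multiplicity \<open>s p\<close>, the multinomial coefficient counts the lists with given multiplicities.

  Both counts of arrangements are counts of lists with a given multiset of entries, and both
  are instances of \<open>sum_lists_by_mset\<close>: first for lists of blocks, then for lists of partitions. The
  bijections \<open>bij_betw_partition_list\<close> and \<open>bij_betw_families\<close> connect the two levels.
\<close>

section \<open>Block decompositions of a word\<close>

definition expand :: "('a \<times> nat) list \<Rightarrow> 'a list" where
  "expand bs = concat (map (\<lambda>(x, l). replicate l x) bs)"

lemma expand_simps [simp]:
  "expand [] = []"
  "expand ((x, l) # bs) = replicate l x @ expand bs"
  by (simp_all add: expand_def)

text \<open>A word of length \<open>N\<close> that is cut into \<open>N - m\<close> blocks has \<open>m\<close> of its matches glued. The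
  equation \<open>length bs + m = length a\<close> expresses this without truncated subtraction, and it leaves
  no decomposition when \<open>m > length a\<close>.\<close>

definition blocks :: "'a list \<Rightarrow> nat \<Rightarrow> ('a \<times> nat) list set" where
  "blocks a m = {bs. expand bs = a \<and> (\<forall>b\<in>set bs. 1 \<le> snd b) \<and> length bs + m = length a}"

fun bump :: "('a \<times> nat) list \<Rightarrow> ('a \<times> nat) list" where
  "bump [] = []"
| "bump ((x, l) # bs) = (x, Suc l) # bs"

lemma inj_bump: "inj bump"
proof (rule injI)
  fix b c :: "('a \<times> nat) list"
  show "bump b = bump c \<Longrightarrow> b = c"
    by (cases b rule: bump.cases; cases c rule: bump.cases) auto
qed

lemma matches_simps:
  "matches [] = 0"
  "matches [x] = 0"
  "matches (x # y # a) = (if x = y then 1 else 0) + matches (y # a)"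
proof -
  have "{i. Suc i < length (x # y # a) \<and> (x # y # a) ! i = (x # y # a) ! Suc i}
    = (if x = y then {0} else {}) \<union> Suc ` {i. Suc i < length (y # a) \<and> (y # a) ! i = (y # a) ! Suc i}"
    (is "?L = ?R \<union> Suc ` ?S")
  proof (intro set_eqI)
    fix i show "i \<in> ?L \<longleftrightarrow> i \<in> ?R \<union> Suc ` ?S"
      by (cases i) (auto simp: image_iff)
  qed
  moreover have "finite ?S" by (rule finite_subset[of _ "{..length (y # a)}"]) auto
  ultimately show "matches (x # y # a) = (if x = y then 1 else 0) + matches (y # a)"
    by (auto simp: matches_def card_image)
qed (auto simp: matches_def)

lemma blocks_Nil: "blocks [] m = (if m = 0 then {[]} else {})"
  by (auto simp: blocks_def)

text \<open>The letter put in front of \<open>a\<close> either forms a block of its own, or it is glued to the first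
  block, which must then carry the same letter. Only the second option uses a match. On
  cardinalities, this is Pascal's rule.\<close>

lemma blocks_Cons:
  "blocks (x # a) m = (#) (x, 1) ` blocks a m \<union>
     (if m > 0 then bump ` {bs \<in> blocks a (m - 1). bs \<noteq> [] \<and> fst (hd bs) = x} else {})"
  (is "_ = ?A \<union> ?B")
proof (intro set_eqI iffI)
  fix bs assume bs: "bs \<in> blocks (x # a) m"
  then obtain y l cs where c: "bs = (y, Suc l) # cs"
    by (cases bs rule: bump.cases) (auto simp: blocks_def gr0_conv_Suc Suc_le_eq)
  show "bs \<in> ?A \<union> ?B"
  proof (cases l)
    case 0
    then show ?thesis using bs c by (auto simp: blocks_def)
  next
    case (Suc l')
    have len: "length cs \<le> length (expand cs)"
      if "\<forall>b\<in>set cs. 1 \<le> snd b" for cs :: "('a \<times> nat) list"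
      using that by (induction cs) auto
    have a: "a = replicate l x @ expand cs" "y = x" using bs c by (auto simp: blocks_def)
    have "length cs \<le> length (expand cs)" using len bs c by (auto simp: blocks_def)
    \<comment> \<open>the first block has length at least 2, so there are fewer blocks than letters\<close>
    then have "m > 0" using bs c a Suc by (auto simp: blocks_def)
    moreover have "(x, l) # cs \<in> blocks a (m - 1)" using bs c a Suc \<open>m > 0\<close> by (auto simp: blocks_def)
    ultimately show ?thesis using c a(2) by (force intro!: rev_image_eqI[of "(x, l) # cs"])
  qed
next
  fix bs assume "bs \<in> ?A \<union> ?B"
  then show "bs \<in> blocks (x # a) m"
  proof
    assume "bs \<in> ?A" then show ?thesis by (auto simp: blocks_def)
  next
    assume "bs \<in> ?B"
    then obtain cs where "m > 0" "cs \<in> blocks a (m - 1)" "cs \<noteq> []" "fst (hd cs) = x" "bs = bump cs"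
      by (auto split: if_splits)
    then show ?thesis by (cases cs rule: bump.cases) (auto simp: blocks_def)
  qed
qed

lemma blocks_hd:
  assumes "bs \<in> blocks (y # a) m"
  shows "bs \<noteq> [] \<and> fst (hd bs) = y"
  using assms by (cases bs rule: bump.cases) (auto simp: blocks_def gr0_conv_Suc Suc_le_eq)

text \<open>A block decomposition amounts to the set of matches that lie inside its blocks, and this can be
  any set of matches. The induction replaces this bijection by Pascal's rule.\<close>

lemma card_blocks: "finite (blocks a m) \<and> card (blocks a m) = (matches a choose m)"
proof (induction a arbitrary: m)
  case Nil
  then show ?case by (auto simp: blocks_Nil matches_simps)
next
  case (Cons x a)
  show ?case
  proof (cases a)
    case Nil
    then have "blocks (x # a) m = (if m = 0 then {[(x, 1)]} else {})"
      by (auto simp: blocks_Cons blocks_Nil)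
    then show ?thesis using Nil by (auto simp: matches_simps)
  next
    case a: (Cons y a')
    have *: "{bs \<in> blocks a (m - 1). bs \<noteq> [] \<and> fst (hd bs) = x} = (if x = y then blocks a (m - 1) else {})"
      using blocks_hd[of _ y a' "m - 1"] a by auto
    have eq: "blocks (x # a) m = (#) (x, 1) ` blocks a m \<union>
      (if x = y \<and> m > 0 then bump ` blocks a (m - 1) else {})"
      unfolding blocks_Cons * by auto
    have "(#) (x, 1) ` blocks a m \<inter> bump ` blocks a (m - 1) = {}"
    proof -
      have "bump cs \<noteq> (x, 1) # bs" if "cs \<in> blocks a (m - 1)" for cs bs
        using that by (cases cs rule: bump.cases) (auto simp: blocks_def)
      then show ?thesis by (fastforce simp: image_iff dest: sym)
    qed
    moreover have "card ((#) (x, 1) ` blocks a m) = (matches a choose m)"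
      using Cons.IH by (subst card_image) auto
    moreover have "card (bump ` blocks a (m - 1)) = (matches a choose (m - 1))"
      using Cons.IH by (subst card_image) (auto intro: inj_on_subset[OF inj_bump])
    moreover have "matches (x # a) = (if x = y then 1 else 0) + matches a"
      unfolding a by (rule matches_simps)
    ultimately show ?thesis unfolding eq using Cons.IH
      by (cases m) (auto simp: card_Un_disjoint)
  qed
qed

section \<open>Counting lists by their multisets\<close>

text \<open>The product may run over any finite superset of the support, since the additional factors are
  \<open>0! = 1\<close>; the superset can thus be the full index set of a formula such as the one defining
  \<open>\<beta>\<^sub>m\<close>.\<close>

lemma real_card_permutations_of_multiset:
  assumes "finite X" "set_mset M \<subseteq> X"
  shows "real (card (permutations_of_multiset M)) = fact (size M) / (\<Prod>x\<in>X. fact (count M x))"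
proof -
  have "(\<Prod>x\<in>X. fact (count M x) :: nat) = (\<Prod>x\<in>set_mset M. fact (count M x))"
    using assms by (intro prod.mono_neutral_right) (auto simp: not_in_iff)
  then have "card (permutations_of_multiset M) * (\<Prod>x\<in>X. fact (count M x)) = fact (size M)"
    using card_permutations_of_multiset_aux[of M] by simp
  then have "real (card (permutations_of_multiset M) * (\<Prod>x\<in>X. fact (count M x))) = real (fact (size M))"
    by (rule arg_cong)
  moreover have "(\<Prod>x\<in>X. fact (count M x) :: real) \<noteq> 0" using assms(1) by simp
  ultimately show ?thesis by (simp add: eq_divide_eq)
qed

lemma sum_lists_by_mset:
  fixes F :: "'a multiset \<Rightarrow> real"
  assumes "finite \<M>"
  shows "(\<Sum>xs | mset xs \<in> \<M>. F (mset xs)) =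
    (\<Sum>M\<in>\<M>. real (card (permutations_of_multiset M)) * F M)"
proof -
  have "{xs. mset xs \<in> \<M>} = (\<Union>M\<in>\<M>. permutations_of_multiset M)"
    by (auto simp: permutations_of_multiset_def)
  then have "(\<Sum>xs | mset xs \<in> \<M>. F (mset xs)) =
    (\<Sum>M\<in>\<M>. \<Sum>xs\<in>permutations_of_multiset M. F (mset xs))"
    using assms by (simp only:, subst sum.UNION_disjoint) (auto simp: permutations_of_multiset_def[symmetric] dest: permutations_of_multisetD)
  also have "\<dots> = (\<Sum>M\<in>\<M>. real (card (permutations_of_multiset M)) * F M)"
    by (intro sum.cong refl) (simp add: permutations_of_multiset_def)
  finally show ?thesis .
qed

lemma sum_mset_over:
  fixes f :: "'a \<Rightarrow> nat"
  assumes "finite X" "set_mset M \<subseteq> X"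
  shows "(\<Sum>x\<in>#M. f x) = (\<Sum>x\<in>X. count M x * f x)"
proof -
  show ?thesis using assms(2)
  proof (induction M)
    case (add y M)
    have "(\<Sum>x\<in>X. count (add_mset y M) x * f x) =
      (\<Sum>x\<in>X. (if x = y then f x else 0) + count M x * f x)"
      by (intro sum.cong) auto
    then show ?case using add assms(1) by (simp add: sum.distrib)
  qed simp
qed

lemma size_over:
  assumes "finite X" "set_mset M \<subseteq> X"
  shows "size M = (\<Sum>x\<in>X. count M x)"
  using sum_mset_over[OF assms, of "\<lambda>_. 1"] by simp

section \<open>Block multisets and lists of partitions\<close>

text \<open>The reason behind \<open>\<mu>\<close>: a part \<open>i\<close> glues \<open>i\<close> letters and thereby uses up \<open>i - 1\<close> matches.\<close>

lemma parts_plus_mu: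
  assumes "p \<in> partitions k"
  shows "(\<Sum>i=1..k. p i) + mu k p = k"
proof -
  have "(\<Sum>i=1..k. p i) + mu k p = (\<Sum>i=1..k. i * p i)"
    unfolding mu_def sum.distrib[symmetric]
    by (intro sum.cong refl) (auto simp: algebra_simps diff_mult_distrib2)
  then show ?thesis using assms by (simp add: partitions_def)
qed

lemma mu_le:
  assumes "p \<in> partitions k" "k \<ge> 1"
  shows "mu k p \<le> k - 1"
proof -
  have "(\<Sum>i=1..k. p i) \<noteq> 0"
  proof
    assume "(\<Sum>i=1..k. p i) = 0"
    then have "(\<Sum>i=1..k. i * p i) = 0" by simp
    then show False using assms by (simp add: partitions_def)
  qed
  then show ?thesis using parts_plus_mu[OF assms(1)] by linarith
qed

definition weight :: "'a \<Rightarrow> ('a \<times> nat) multiset \<Rightarrow> nat" where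
  "weight j B = (\<Sum>(x, l)\<in>#B. if x = j then l else 0)"

lemma count_expand: "count (mset (expand bs)) j = weight j (mset bs)"
  by (induction bs) (auto simp: weight_def)

text \<open>The multisets of blocks that occur in decompositions with \<open>m\<close> glued matches of the words
  in question.\<close>

definition block_msets :: "nat \<Rightarrow> nat \<Rightarrow> nat \<Rightarrow> (nat \<times> nat) multiset set" where
  "block_msets k n m = {B. (\<forall>b\<in>#B. 1 \<le> snd b) \<and>
     (\<forall>j. weight j B = (if j \<in> {1..n} then k else 0)) \<and> size B + m = k * n}"

lemma union_blocks:
  "(\<Union>a\<in>permutations_of_multiset (copies_mset k n). blocks a m) = {bs. mset bs \<in> block_msets k n m}"
proof -
  have s: "size (copies_mset k n) = k * n" by (simp add: copies_mset_def)
  have m: "mset (expand bs) = copies_mset k n \<longleftrightarrow>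
      (\<forall>j. weight j (mset bs) = (if j \<in> {1..n} then k else 0))" for bs
    by (simp only: multiset_eq_iff count_expand count_copies_mset)
  have "bs \<in> (\<Union>a\<in>permutations_of_multiset (copies_mset k n). blocks a m) \<longleftrightarrow>
     mset (expand bs) = copies_mset k n \<and> (\<forall>b\<in>set bs. 1 \<le> snd b) \<and> length bs + m = length (expand bs)" for bs
    by (auto simp: blocks_def permutations_of_multiset_def)
  moreover have "length (expand bs) = k * n" if "mset (expand bs) = copies_mset k n" for bs
    using arg_cong[OF that, of size] s by simp
  ultimately have "bs \<in> (\<Union>a\<in>permutations_of_multiset (copies_mset k n). blocks a m) \<longleftrightarrow>
     mset bs \<in> block_msets k n m" for bs
    unfolding block_msets_def mem_Collect_eq set_mset_mset size_mset m[symmetric] by metis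
  then show ?thesis by blast
qed

lemma sum_choose_matches:
  "(\<Sum>a\<in>permutations_of_multiset (copies_mset k n). real (matches a choose m)) =
     real (card {bs. mset bs \<in> block_msets k n m})"
proof -
  have "card (\<Union>a\<in>permutations_of_multiset (copies_mset k n). blocks a m) =
    (\<Sum>a\<in>permutations_of_multiset (copies_mset k n). card (blocks a m))"
    using card_blocks by (intro card_UN_disjoint) (auto simp: blocks_def)
  then show ?thesis by (simp add: card_blocks union_blocks)
qed

lemma weight_over:
  fixes B :: "('a \<times> nat) multiset"
  assumes "finite X" "set_mset B \<subseteq> X \<times> {1..k}"
  shows "weight j B = (if j \<in> X then \<Sum>i=1..k. i * count B (j, i) else 0)"
proof -
  have "weight j B = (\<Sum>x\<in>X \<times> {1..k}. count B x * (case x of (x, l) \<Rightarrow> if x = j then l else 0))"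
    unfolding weight_def using assms by (intro sum_mset_over) auto
  also have "\<dots> = (\<Sum>x\<in>X. \<Sum>i=1..k. if x = j then i * count B (j, i) else 0)"
    unfolding sum.cartesian_product by (intro sum.cong refl) auto
  also have "\<dots> = (\<Sum>x\<in>X. if x = j then \<Sum>i=1..k. i * count B (j, i) else 0)"
    by (intro sum.cong) auto
  also have "\<dots> = (if j \<in> X then \<Sum>i=1..k. i * count B (j, i) else 0)"
    using assms by (simp add: sum.delta')
  finally show ?thesis .
qed

text \<open>Read one letter at a time, the conditions on the blocks say that the block lengths of each letter
  form a partition of \<open>k\<close>. The total number of blocks is then determined by the values of \<open>\<mu>\<close>.\<close>

lemma block_msets_altdef:
  "block_msets k n m = {B. set_mset B \<subseteq> {1..n} \<times> {1..k} \<and>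
     (\<forall>j\<in>{1..n}. (\<lambda>i. count B (j, i)) \<in> partitions k) \<and>
     (\<Sum>j=1..n. mu k (\<lambda>i. count B (j, i))) = m}"
proof (intro set_eqI)
  fix B :: "(nat \<times> nat) multiset"
  have sub: "set_mset B \<subseteq> {1..n} \<times> {1..k}" if "B \<in> block_msets k n m"
  proof clarify
    fix j l assume jl: "(j, l) \<in># B"
    then obtain C where C: "B = add_mset (j, l) C" by (meson multi_member_split)
    have "1 \<le> l" "l \<le> weight j B" using that jl by (auto simp: block_msets_def C weight_def)
    moreover have "weight j B = (if j \<in> {1..n} then k else 0)" using that by (simp add: block_msets_def)
    ultimately show "j \<in> {1..n} \<and> l \<in> {1..k}" by (auto split: if_splits)
  qed
  have "B \<in> block_msets k n m \<longleftrightarrow> (\<forall>j\<in>{1..n}. (\<lambda>i. count B (j, i)) \<in> partitions k) \<and>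
     (\<Sum>j=1..n. mu k (\<lambda>i. count B (j, i))) = m" if s: "set_mset B \<subseteq> {1..n} \<times> {1..k}"
  proof -
    have 0: "count B (j, i) = 0" if "i \<notin> {1..k}" for i j
      using s that by (intro not_in_iff[THEN iffD1]) auto
    have "(\<forall>b\<in>#B. 1 \<le> snd b)" using s by fastforce
    moreover have "(\<forall>j. weight j B = (if j \<in> {1..n} then k else 0)) \<longleftrightarrow>
        (\<forall>j\<in>{1..n}. (\<lambda>i. count B (j, i)) \<in> partitions k)"
      unfolding weight_over[OF finite_atLeastAtMost s] partitions_def using 0 by auto
    moreover have "size B + m = k * n \<longleftrightarrow> (\<Sum>j=1..n. mu k (\<lambda>i. count B (j, i))) = m"
      if p: "\<forall>j\<in>{1..n}. (\<lambda>i. count B (j, i)) \<in> partitions k"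
    proof -
      have "size B = (\<Sum>j=1..n. \<Sum>i=1..k. count B (j, i))"
        using size_over[OF _ s] by (simp add: sum.cartesian_product)
      then have "size B + (\<Sum>j=1..n. mu k (\<lambda>i. count B (j, i))) = (\<Sum>j=1..n. k)"
        using p by (simp only: sum.distrib[symmetric]) (intro sum.cong refl parts_plus_mu, blast)
      then show ?thesis by (auto simp: algebra_simps)
    qed
    ultimately show ?thesis unfolding block_msets_def by blast
  qed
  with sub show "B \<in> block_msets k n m \<longleftrightarrow> B \<in> {B. set_mset B \<subseteq> {1..n} \<times> {1..k} \<and>
     (\<forall>j\<in>{1..n}. (\<lambda>i. count B (j, i)) \<in> partitions k) \<and>
     (\<Sum>j=1..n. mu k (\<lambda>i. count B (j, i))) = m}" by blast
qed

definition part_msets :: "nat \<Rightarrow> nat \<Rightarrow> nat \<Rightarrow> (nat \<Rightarrow> nat) multiset set" where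
  "part_msets k n m = {M. set_mset M \<subseteq> partitions k \<and> size M = n \<and> (\<Sum>p\<in>#M. mu k p) = m}"

definition partition_list :: "nat \<Rightarrow> (nat \<times> nat) multiset \<Rightarrow> (nat \<Rightarrow> nat) list" where
  "partition_list n B = map (\<lambda>j i. count B (j, i)) [1..<Suc n]"

lemma sum_list_partition_list:
  "sum_list (map f (partition_list n B)) = (\<Sum>j=1..n. f (\<lambda>i. count B (j, i)))"
  unfolding partition_list_def map_map
  by (simp only: interv_sum_list_conv_sum_set_nat o_def atLeastLessThanSuc_atLeastAtMost set_upt)

lemma prod_list_partition_list:
  "prod_list (map f (partition_list n B)) = (\<Prod>j=1..n. f (\<lambda>i. count B (j, i)))"
  by (induction n) (simp_all add: partition_list_def prod.nat_ivl_Suc' mult.commute)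

lemma bij_betw_partition_list:
  "bij_betw (partition_list n) (block_msets k n m) {xs. mset xs \<in> part_msets k n m}"
proof (rule bij_betw_imageI)
  show "inj_on (partition_list n) (block_msets k n m)"
  proof (rule inj_onI, rule multiset_eqI)
    fix A B and x :: "nat \<times> nat"
    assume AB: "A \<in> block_msets k n m" "B \<in> block_msets k n m" "partition_list n A = partition_list n B"
    obtain j i where x: "x = (j, i)" by (cases x)
    show "count A x = count B x"
    proof (cases "j \<in> {1..n}")
      case True
      then have "(\<lambda>i. count A (j, i)) = (\<lambda>i. count B (j, i))"
        using AB(3) unfolding partition_list_def map_eq_conv set_upt by fastforce
      then show ?thesis using x by (auto dest: fun_cong)
    next
      case False
      then have "x \<notin># A" "x \<notin># B" using AB(1,2) x by (auto simp: block_msets_altdef)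
      then show ?thesis by (simp add: not_in_iff)
    qed
  qed
  show "partition_list n ` block_msets k n m = {xs. mset xs \<in> part_msets k n m}"
  proof (intro equalityI subsetI)
    fix xs assume "xs \<in> partition_list n ` block_msets k n m"
    then obtain B where B: "B \<in> block_msets k n m" "xs = partition_list n B" by blast
    have "set xs \<subseteq> partitions k" "length xs = n"
      using B by (auto simp: partition_list_def block_msets_altdef)
    moreover have "(\<Sum>p\<in>#mset xs. mu k p) = m"
      using B sum_list_partition_list[of "mu k" n B]
      by (simp add: block_msets_altdef flip: sum_mset_sum_list)
    ultimately show "xs \<in> {xs. mset xs \<in> part_msets k n m}" by (simp add: part_msets_def)
  next
    fix xs assume "xs \<in> {xs. mset xs \<in> part_msets k n m}"
    then have xs: "set xs \<subseteq> partitions k" "length xs = n" "sum_list (map (mu k) xs) = m"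
      by (auto simp: part_msets_def simp flip: sum_mset_sum_list)
    define c where "c = (\<lambda>(j, i). if j \<in> {1..n} then (xs ! (j - 1)) i else 0)"
    have p: "xs ! (j - 1) \<in> partitions k" if "j \<in> {1..n}" for j
      using xs that by (intro subsetD[OF xs(1)] nth_mem) auto
    have sub: "{x. 0 < c x} \<subseteq> {1..n} \<times> {1..k}"
      using p by (force simp: c_def partitions_def split: if_splits)
    define B where "B = Abs_multiset c"
    have cB: "count B = c" unfolding B_def
      using finite_subset[OF sub] by (intro count_Abs_multiset) auto
    have e: "partition_list n B = xs"
      using xs(2) by (intro nth_equalityI) (auto simp: partition_list_def cB c_def simp del: upt_Suc)
    have "set_mset B \<subseteq> {1..n} \<times> {1..k}"
      using sub by (simp add: set_mset_def cB)
    moreover have "(\<lambda>i. count B (j, i)) \<in> partitions k" if "j \<in> {1..n}" for j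
      using p[OF that] that by (simp add: cB c_def)
    moreover have "(\<Sum>j=1..n. mu k (\<lambda>i. count B (j, i))) = m"
      using xs(3) sum_list_partition_list[of "mu k" n B] e by simp
    ultimately have "B \<in> block_msets k n m" by (simp add: block_msets_altdef)
    then show "xs \<in> partition_list n ` block_msets k n m" using e by blast
  qed
qed

section \<open>Multisets of partitions and families\<close>

lemma bij_betw_families:
  "bij_betw (\<lambda>M. restrict (count M) (partitions k)) (part_msets k n m) (families k n m)"
proof (rule bij_betw_imageI)
  show "inj_on (\<lambda>M. restrict (count M) (partitions k)) (part_msets k n m)"
  proof (rule inj_onI, rule multiset_eqI)
    fix A B p
    assume AB: "A \<in> part_msets k n m" "B \<in> part_msets k n m"
      "restrict (count A) (partitions k) = restrict (count B) (partitions k)"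
    show "count A p = count B p"
    proof (cases "p \<in> partitions k")
      case True
      then show ?thesis using fun_cong[OF AB(3), of p] by simp
    next
      case False
      then have "p \<notin># A" "p \<notin># B" using AB(1,2) by (auto simp: part_msets_def)
      then show ?thesis by (simp add: not_in_iff)
    qed
  qed
  show "(\<lambda>M. restrict (count M) (partitions k)) ` part_msets k n m = families k n m"
  proof (intro equalityI subsetI)
    fix s assume "s \<in> (\<lambda>M. restrict (count M) (partitions k)) ` part_msets k n m"
    then show "s \<in> families k n m"
      by (auto simp: families_def part_msets_def sum_mset_over[OF finite_partitions]
           size_over[OF finite_partitions])
  next
    fix s assume s: "s \<in> families k n m"
    define c where "c p = (if p \<in> partitions k then s p else 0)" for p
    define M where "M = Abs_multiset c"
    have sub: "{p. 0 < c p} \<subseteq> partitions k" by (auto simp: c_def)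
    have cM: "count M = c" unfolding M_def
      using finite_subset[OF sub finite_partitions] by (intro count_Abs_multiset) auto
    have "set_mset M \<subseteq> partitions k" using sub by (simp add: set_mset_def cM)
    then have "M \<in> part_msets k n m" using s
      by (auto simp: families_def part_msets_def sum_mset_over[OF finite_partitions]
           size_over[OF finite_partitions] cM c_def)
    moreover have "restrict (count M) (partitions k) = s"
      using s by (auto simp: cM c_def families_def PiE_iff extensional_def restrict_def)
    ultimately show "s \<in> (\<lambda>M. restrict (count M) (partitions k)) ` part_msets k n m" by blast
  qed
qed

lemma finite_part_msets: "finite (part_msets k n m)"
  using bij_betw_finite[OF bij_betw_families] finite_families by blast

lemma finite_block_msets: "finite (block_msets k n m)"
proof -
  have "{xs. mset xs \<in> part_msets k n m} = (\<Union>M\<in>part_msets k n m. permutations_of_multiset M)"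
    by (auto simp: permutations_of_multiset_def)
  then have "finite {xs. mset xs \<in> part_msets k n m}" using finite_part_msets by simp
  then show ?thesis using bij_betw_finite[OF bij_betw_partition_list] by blast
qed

lemma sum_choose_matches_eq_beta:
  "(\<Sum>a\<in>permutations_of_multiset (copies_mset k n). real (matches a choose m)) = beta k n m"
proof -
  define g :: "(nat \<Rightarrow> nat) \<Rightarrow> real" where "g p = (\<Prod>i=1..k. fact (p i))" for p
  define F where "F M = fact (k * n - m) / (\<Prod>p\<in>#M. g p)" for M
  have B: "real (card (permutations_of_multiset B)) = F (mset (partition_list n B))"
    if "B \<in> block_msets k n m" for B
  proof -
    have "set_mset B \<subseteq> {1..n} \<times> {1..k}" using that by (simp add: block_msets_altdef)
    then have "real (card (permutations_of_multiset B)) =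
      fact (size B) / (\<Prod>x\<in>{1..n} \<times> {1..k}. fact (count B x))"
      by (intro real_card_permutations_of_multiset) auto
    also have "(\<Prod>x\<in>{1..n} \<times> {1..k}. fact (count B x)) = (\<Prod>j=1..n. g (\<lambda>i. count B (j, i)))"
      by (simp add: g_def prod.cartesian_product)
    also have "\<dots> = (\<Prod>p\<in>#mset (partition_list n B). g p)"
      by (simp only: prod_list_partition_list[symmetric] prod_mset_prod_list[symmetric] mset_map)
    also have "size B = k * n - m" using that by (auto simp: block_msets_def)
    finally show ?thesis by (simp add: F_def)
  qed
  have M: "real (card (permutations_of_multiset M)) * F M =
      (\<lambda>s. multinomial k n s * (fact (k * n - m) / (\<Prod>p\<in>partitions k. \<Prod>i=1..k. fact (p i) ^ s p)))
        (restrict (count M) (partitions k))"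
    if "M \<in> part_msets k n m" for M
  proof -
    have s: "set_mset M \<subseteq> partitions k" "size M = n" using that by (auto simp: part_msets_def)
    have "(\<Prod>p\<in>#M. g p) = (\<Prod>p\<in>set_mset M. g p ^ count M p)"
      by (rule image_prod_mset_multiplicity)
    also have "\<dots> = (\<Prod>p\<in>partitions k. g p ^ count M p)"
      using s finite_partitions by (intro prod.mono_neutral_left) (auto simp: not_in_iff)
    finally have "F M = fact (k * n - m) / (\<Prod>p\<in>partitions k. \<Prod>i=1..k. fact (p i) ^ count M p)"
      by (simp add: F_def g_def prod_power_distrib)
    then show ?thesis
      using real_card_permutations_of_multiset[OF finite_partitions s(1)] s(2)
      by (simp add: multinomial_def)
  qed
  have "(\<Sum>a\<in>permutations_of_multiset (copies_mset k n). real (matches a choose m)) =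
      (\<Sum>bs | mset bs \<in> block_msets k n m. 1)"
    by (simp add: sum_choose_matches)
  also have "\<dots> = (\<Sum>B\<in>block_msets k n m. real (card (permutations_of_multiset B)))"
    using sum_lists_by_mset[OF finite_block_msets, of "\<lambda>_. 1"] by simp
  also have "\<dots> = (\<Sum>B\<in>block_msets k n m. F (mset (partition_list n B)))"
    by (intro sum.cong B refl)
  also have "\<dots> = (\<Sum>xs | mset xs \<in> part_msets k n m. F (mset xs))"
    by (rule sum.reindex_bij_betw[OF bij_betw_partition_list])
  also have "\<dots> = (\<Sum>M\<in>part_msets k n m. real (card (permutations_of_multiset M)) * F M)"
    by (rule sum_lists_by_mset[OF finite_part_msets])
  also have "\<dots> = beta k n m"
    unfolding beta_def sum.reindex_bij_betw[OF bij_betw_families, symmetric]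
    by (intro sum.cong M refl)
  finally show ?thesis .
qed

section \<open>Binomial inversion\<close>

text \<open>Each of the \<open>n\<close> letters has at least one block, hence at most \<open>k - 1\<close> glued matches. Since
  \<open>\<beta>\<^sub>m\<close> counts selections of \<open>m\<close> matches, this also bounds the number of matches of every word,
  by taking \<open>m = matches a\<close>.\<close>

lemma families_empty:
  assumes "k \<ge> 1" "m > (k - 1) * n"
  shows "families k n m = {}"
proof -
  have "m \<le> (k - 1) * n" if "s \<in> families k n m" for s
  proof -
    have "m = (\<Sum>p\<in>partitions k. s p * mu k p)" using that by (simp add: families_def)
    also have "\<dots> \<le> (\<Sum>p\<in>partitions k. s p * (k - 1))"
      using mu_le assms(1) by (intro sum_mono mult_le_mono2) auto
    also have "\<dots> = (k - 1) * n"
      using that by (simp add: families_def flip: sum_distrib_right)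
    finally show ?thesis .
  qed
  then show ?thesis using assms(2) by (meson all_not_in_conv not_less)
qed

lemma matches_le:
  assumes "k \<ge> 1" "a \<in> permutations_of_multiset (copies_mset k n)"
  shows "matches a \<le> (k - 1) * n"
proof (rule ccontr)
  assume "\<not> ?thesis"
  then have "families k n (matches a) = {}" using assms(1) by (intro families_empty) auto
  then have "(\<Sum>b\<in>permutations_of_multiset (copies_mset k n). real (matches b choose matches a)) = 0"
    by (simp add: sum_choose_matches_eq_beta beta_def)
  then have "real (matches a choose matches a) = 0"
    using assms(2) by (subst (asm) sum_nonneg_eq_0_iff) auto
  then show False by simp
qed

lemma binomial_inversion_kernel:
  fixes M N r :: nat
  assumes "M \<le> N"
  shows "(\<Sum>m=r..N. (-1) ^ (m - r) * real (m choose r) * real (M choose m)) = (if M = r then 1 else 0)"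
proof (cases "r \<le> M")
  case False
  then show ?thesis by (auto intro!: sum.neutral simp: binomial_eq_0)
next
  case True
  have "(\<Sum>m=r..N. (-1) ^ (m - r) * real (m choose r) * real (M choose m)) =
        (\<Sum>m=r..M. (-1) ^ (m - r) * real (m choose r) * real (M choose m))"
    using assms by (intro sum.mono_neutral_right) (auto simp: binomial_eq_0)
  also have "\<dots> = (\<Sum>m=r..M. (-1) ^ (m - r) * (real (M choose r) * real ((M - r) choose (m - r))))"
    by (intro sum.cong refl) (simp add: choose_mult[symmetric] mult.commute flip: of_nat_mult)
  also have "\<dots> = (\<Sum>i\<le>M - r. (-1) ^ i * (real (M choose r) * real ((M - r) choose i)))"
    using True by (intro sum.reindex_bij_witness[of _ "\<lambda>i. i + r" "\<lambda>m. m - r"]) auto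
  also have "\<dots> = real (M choose r) * (\<Sum>i\<le>M - r. (-1) ^ i * real ((M - r) choose i))"
    by (simp add: sum_distrib_left mult_ac)
  also have "\<dots> = (if M = r then 1 else 0)"
    using True choose_alternating_sum[of "M - r", where 'a = real] by auto
  finally show ?thesis .
qed

theorem mainTheorem5:
  fixes k n r :: nat
  assumes "k \<ge> 1" and "n \<ge> 1" and "r \<le> (k - 1) * n"
  shows "real (alpha k n r) =
    (\<Sum>m=r..(k - 1) * n. (-1) ^ (m - r) * real (m choose r) * beta k n m)"
proof -
  define P where "P = permutations_of_multiset (copies_mset k n)"
  have "(\<Sum>m=r..(k - 1) * n. (-1) ^ (m - r) * real (m choose r) * beta k n m) =
    (\<Sum>m=r..(k - 1) * n. \<Sum>a\<in>P. (-1) ^ (m - r) * real (m choose r) * real (matches a choose m))"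
    by (simp add: P_def sum_distrib_left flip: sum_choose_matches_eq_beta)
  also have "\<dots> =
    (\<Sum>a\<in>P. \<Sum>m=r..(k - 1) * n. (-1) ^ (m - r) * real (m choose r) * real (matches a choose m))"
    by (rule sum.swap)
  also have "\<dots> = (\<Sum>a\<in>P. if matches a = r then 1 else 0)"
    using matches_le[OF assms(1)] by (intro sum.cong refl binomial_inversion_kernel) (simp add: P_def)
  also have "\<dots> = real (alpha k n r)"
    by (simp add: P_def alpha_def sum.If_cases Int_def)
  finally show ?thesis by simp
qed

end
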